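(* Let $F:\mathbb{R}^n\times\mathbb{R}^d\to\mathbb{R}^n$ be continuously differentiable in both arguments, let $\Theta\subseteq\mathbb{R}^d$, and let $\theta:[0,\infty)\to\Theta$ be continuously differentiable. Assume there exist a norm $\|\cdot\|_{\mathcal{X}}$ and $c>0$ such that for all $\theta\in\Theta$ the map $x\mapsto F(x,\theta)$ is strongly infinitesimally contracting with respect to $\|\cdot\|_{\mathcal{X}}$ with rate $c$, i.e. $\operatorname{osL}_x(F)\le -c$. Let $x(\cdot)$ be a solution of the dynamics with feedforward prediction $$\dot x(t)=F(x(t),\theta(t))-\bigl(D_xF(x(t),\theta(t))\bigr)^{-1}D_\theta F(x(t),\theta(t))\,\dot\theta(t).$$ Then for all $t\ge0$: (i) $\|F(x(t),\theta(t))\|_{\mathcal{X}}\le e^{-ct}\|F(x(0),\theta(0))\|_{\mathcal{X}}$; (ii) $\|x(t)-x^\star(\theta(t))\|_{\mathcal{X}}\le\frac1c e^{-ct}\|F(x(0),\theta(0))\|_{\mathcal{X}}$. Additionally, if $F$ is Lipschitz in its first argument with constant $\ell_x$ (with respect to $\|\cdot\|_{\mathcal{X}}$) uniformly in $\theta$, then $$\|x(t)-x^\star(\theta(t))\|_{\mathcal{X}}\le\frac{\ell_x}{c}e^{-ct}\|x(0)-x^\star(\theta(0))\|_{\mathcal{X}}.$$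
   Context: $\|\cdot\|_{\mathcal{X}}$ is a norm on $\mathbb{R}^n$ and the state takes values in $\mathcal{X}\subseteq\mathbb{R}^n$. $D_xF$ and $D_\theta F$ are the partial Jacobians of $F$ with respect to $x$ and $\theta$. One-sided Lipschitz constant: for a continuous $G:\mathbb{R}^n\to\mathbb{R}^n$ and a norm $\|\cdot\|$, $\operatorname{osL}(G)\le b$ means that for all $x\ne y$, $\lim_{h\to0^+}\frac{\|x-y+h(G(x)-G(y))\|-\|x-y\|}{h}\le b\|x-y\|$. For locally Lipschitz $G$ this is equivalent to $\mu(DG(x))\le b$ for almost every $x$, where $\mu(A)=\lim_{h\to0^+}(\|I_n+hA\|-1)/h$ is the logarithmic norm. $\operatorname{osL}_x(F)\le -c$ means $\operatorname{osL}(F(\cdot,\theta))\le -c$ for every $\theta\in\Theta$. Under this condition $\mu(D_xF(x,\theta))\le -c$, so that $D_xF(x,\theta)$ is invertible and the dynamics are well-posed. For each $\theta\in\Theta$ there is a unique $x^\star_\theta\in\mathcal{X}$ with $F(x^\star_\theta,\theta)=0$; $x^\star(\theta):=x^\star_\theta$. *)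

theory Defs
  imports "HOL-Analysis.Analysis"
begin

text \<open>
  The norm on the state space is an arbitrary one, not the Euclidean norm that the type
  \<open>real ^ 'n\<close> carries by its class instance, so it is a function subject to the norm axioms.
  Topological notions (limits, derivatives, continuity) do not depend on this choice, since
  all norms on a finite-dimensional space are equivalent.
\<close>

definition is_norm :: "('a::real_vector \<Rightarrow> real) \<Rightarrow> bool" where
  "is_norm N \<longleftrightarrow>
     (\<forall>v. 0 \<le> N v) \<and>
     (\<forall>v. N v = 0 \<longleftrightarrow> v = 0) \<and>
     (\<forall>a v. N (a *\<^sub>R v) = \<bar>a\<bar> * N v) \<and>
     (\<forall>v w. N (v + w) \<le> N v + N w)"

text \<open>
  \<open>osL_le N G b\<close> is \<open>osL(G) \<le> b\<close> with respect to \<open>N\<close>.  The one-sided limit exists for every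
  norm, by convexity; quantifying over it existentially avoids the unspecified value of a limit
  operator.
\<close>

definition osL_le :: "('a::real_vector \<Rightarrow> real) \<Rightarrow> ('a \<Rightarrow> 'a) \<Rightarrow> real \<Rightarrow> bool" where
  "osL_le N G b \<longleftrightarrow>
     (\<forall>x y. x \<noteq> y \<longrightarrow>
        (\<exists>L. ((\<lambda>h. (N (x - y + h *\<^sub>R (G x - G y)) - N (x - y)) / h) \<longlongrightarrow> L) (at_right 0) \<and>
             L \<le> b * N (x - y)))"

definition continuously_differentiable ::
    "('a::real_normed_vector \<Rightarrow> 'b::real_normed_vector) \<Rightarrow> bool" where
  "continuously_differentiable f \<longleftrightarrow>
     (\<exists>f'. (\<forall>z. (f has_derivative blinfun_apply (f' z)) (at z)) \<and> continuous_on UNIV f')"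

text \<open>
  Continuous differentiability on \<open>[0,\<infinity>)\<close>, with the one-sided derivative at \<open>0\<close>.  The library's
  \<open>C1_differentiable_on\<close> asks for two-sided derivatives at every point of the set and would
  constrain the junk values at negative times.
\<close>

definition dot :: "(real \<Rightarrow> 'a::real_normed_vector) \<Rightarrow> real \<Rightarrow> 'a" where
  "dot f t = vector_derivative f (at t within {0..})"

definition C1_nonneg :: "(real \<Rightarrow> 'a::real_normed_vector) \<Rightarrow> bool" where
  "C1_nonneg f \<longleftrightarrow>
     (\<forall>t\<ge>0. (f has_vector_derivative dot f t) (at t within {0..})) \<and> continuous_on {0..} (dot f)"

definition Jac_x :: "((real ^ 'n) \<times> (real ^ 'd) \<Rightarrow> real ^ 'n) \<Rightarrow> real ^ 'n \<Rightarrow> real ^ 'd \<Rightarrow> real ^ 'n ^ 'n" where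
  "Jac_x F x \<theta> = jacobian (\<lambda>x'. F (x', \<theta>)) (at x)"

definition Jac_theta :: "((real ^ 'n) \<times> (real ^ 'd) \<Rightarrow> real ^ 'n) \<Rightarrow> real ^ 'n \<Rightarrow> real ^ 'd \<Rightarrow> real ^ 'd ^ 'n" where
  "Jac_theta F x \<theta> = jacobian (\<lambda>\<theta>'. F (x, \<theta>')) (at \<theta>)"

definition feedforward_solution ::
    "((real ^ 'n) \<times> (real ^ 'd) \<Rightarrow> real ^ 'n) \<Rightarrow> (real \<Rightarrow> real ^ 'd) \<Rightarrow> (real \<Rightarrow> real ^ 'n) \<Rightarrow> bool" where
  "feedforward_solution F \<theta> x \<longleftrightarrow>
     (\<forall>t\<ge>0. (x has_vector_derivative
        F (x t, \<theta> t) - matrix_inv (Jac_x F (x t) (\<theta> t)) *v (Jac_theta F (x t) (\<theta> t) *v dot \<theta> t))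
        (at t within {0..}))"

definition equilibrium ::
    "((real ^ 'n) \<times> (real ^ 'd) \<Rightarrow> real ^ 'n) \<Rightarrow> (real ^ 'n) set \<Rightarrow> real ^ 'd \<Rightarrow> real ^ 'n" where
  "equilibrium F X \<theta> = (THE x. x \<in> X \<and> F (x, \<theta>) = 0)"

end

theory Submission
  imports Defs
begin

text \<open>
  Along a solution put \<open>y t = F (x t, \<theta> t)\<close> and let \<open>A t\<close> be the partial Jacobian of \<open>F\<close> in the
  state.  The feedforward term is chosen so that in the chain rule it cancels the drift
  caused by the motion of the parameter, which leaves the linear equation \<open>y' = A y\<close>
  (lemma \<open>residual_derivative\<close>).

  Contraction is used only through the one-sided directional derivative of the norm,
  written \<open>N'(v; w)\<close> below and bounded by the predicate \<open>norm_deriv_le\<close>.  By definition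
  \<open>osL(G) \<le> b\<close> says \<open>N'(u - v; G u - G v) \<le> b N(u - v)\<close>.  The norm being Lipschitz, the bound
  \<open>N'(v; w) \<ge> - N w\<close> always holds, and \<open>N'(v; w)\<close> depends continuously on \<open>w\<close>.  This gives three things.

  \<^item> If \<open>b = - c\<close>, then \<open>c N(u - v) \<le> N(G u - G v)\<close> (lemma \<open>osL_le_expansive\<close>), so the residual
    \<open>N (F (x, \<theta>))\<close> controls the distance from \<open>x\<close> to the equilibrium.

  \<^item> Taking \<open>u - v\<close> along a ray that shrinks to a point, the finite differences become a
    derivative: \<open>N'(v; A v) \<le> - c N v\<close> (lemma \<open>osL_le_derivative\<close>).  This is the bound on the
    logarithmic norm of the Jacobian.  In particular \<open>A v = 0\<close> forces \<open>v = 0\<close>, so \<open>A\<close> is invertible.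

  \<^item> Hence the upper right Dini derivative of \<open>N (y t)\<close> is at most \<open>- c N (y t)\<close>, and a comparison
    argument (lemma \<open>dini_gronwall\<close>) gives exponential decay of the residual.
\<close>

section \<open>Norms as functions\<close>

lemma is_normD:
  assumes "is_norm N"
  shows is_norm_nonneg: "0 \<le> N v"
    and is_norm_eq_0_iff: "N v = 0 \<longleftrightarrow> v = 0"
    and is_norm_scaleR: "N (a *\<^sub>R v) = \<bar>a\<bar> * N v"
    and is_norm_triangle: "N (v + w) \<le> N v + N w"
  using assms unfolding is_norm_def by blast+

lemma is_norm_zero:
  assumes "is_norm N"
  shows "N 0 = 0"
  using is_norm_eq_0_iff[OF assms, of 0] by simp

lemma is_norm_minus:
  assumes "is_norm N"
  shows "N (- v) = N v"
  using is_norm_scaleR[OF assms, of "-1" v] by simp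

lemma is_norm_minus_commute:
  assumes "is_norm N"
  shows "N (v - w) = N (w - v)"
  using is_norm_minus[OF assms, of "v - w"] by simp

lemma is_norm_sum_le:
  assumes "is_norm N"
  shows "N (sum f A) \<le> (\<Sum>i\<in>A. N (f i))"
proof (induction A rule: infinite_finite_induct)
  case (insert i A)
  then show ?case
    using is_norm_triangle[OF assms, of "f i" "sum f A"] by simp
qed (simp_all add: is_norm_zero[OF assms])

text \<open>
  Finite dimension enters here: expanding a vector in the basis shows that every norm is dominated
  by the Euclidean one, hence continuous for the standard topology.
\<close>

lemma is_norm_le_norm:
  fixes N :: "'a::euclidean_space \<Rightarrow> real"
  assumes "is_norm N"
  shows "N v \<le> (\<Sum>b\<in>Basis. N b) * norm v"
proof -
  have "N v = N (\<Sum>b\<in>Basis. (v \<bullet> b) *\<^sub>R b)"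
    by (simp add: euclidean_representation)
  also have "\<dots> \<le> (\<Sum>b\<in>Basis. \<bar>v \<bullet> b\<bar> * N b)"
    using is_norm_sum_le[OF assms, of "\<lambda>b. (v \<bullet> b) *\<^sub>R b" Basis]
    by (simp add: is_norm_scaleR[OF assms])
  also have "\<dots> \<le> (\<Sum>b\<in>Basis. norm v * N b)"
    by (intro sum_mono mult_right_mono Basis_le_norm is_norm_nonneg[OF assms])
  also have "\<dots> = (\<Sum>b\<in>Basis. N b) * norm v"
    by (simp add: sum_distrib_right mult.commute[of "norm v"])
  finally show ?thesis .
qed

lemma is_norm_continuous_on:
  fixes N :: "'a::euclidean_space \<Rightarrow> real"
  assumes "is_norm N"
  shows "continuous_on S N"
proof -
  have "\<bar>N v - N w\<bar> \<le> (\<Sum>b\<in>Basis. N b) * norm (v - w)" for v w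
  proof -
    have "\<bar>N v - N w\<bar> \<le> N (v - w)"
      using is_norm_triangle[OF assms, of w "v - w"] is_norm_triangle[OF assms, of v "w - v"]
        is_norm_minus_commute[OF assms, of v w] by simp
    also have "\<dots> \<le> (\<Sum>b\<in>Basis. N b) * norm (v - w)"
      by (rule is_norm_le_norm[OF assms])
    finally show ?thesis .
  qed
  then have "(\<Sum>b\<in>Basis. N b)-lipschitz_on S N"
    by (intro lipschitz_onI) (auto simp: dist_norm is_norm_nonneg[OF assms] intro: sum_nonneg)
  then show ?thesis
    by (rule lipschitz_on_continuous_on)
qed

lemma is_norm_tendsto_diff:
  fixes N :: "'a::euclidean_space \<Rightarrow> real"
  assumes "is_norm N" and "(f \<longlongrightarrow> w) A"
  shows "((\<lambda>s. N (f s - w)) \<longlongrightarrow> 0) A"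
proof -
  have "((\<lambda>s. f s - w) \<longlongrightarrow> 0) A"
    by (rule LIM_zero[OF assms(2)])
  moreover have "isCont N 0"
    using is_norm_continuous_on[OF assms(1), of UNIV] by (simp add: continuous_on_eq_continuous_at)
  ultimately have "((\<lambda>s. N (f s - w)) \<longlongrightarrow> N 0) A"
    by (rule isCont_tendsto_compose[rotated])
  then show ?thesis
    by (simp add: is_norm_zero[OF assms(1)])
qed

section \<open>The one-sided directional derivative of a norm\<close>

lemma right_quotient_tendsto:
  assumes "(f has_vector_derivative w) (at_right t)"
  shows "((\<lambda>h. (f (t + h) - f t) /\<^sub>R h) \<longlongrightarrow> w) (at_right 0)"
proof -
  have "((\<lambda>s. (1 / norm (s - t)) *\<^sub>R (f s - (f t + (s - t) *\<^sub>R w))) \<longlongrightarrow> 0) (at_right t)"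
    using assms by (simp add: has_vector_derivative_def has_derivative_within)
  then have "((\<lambda>h. (1 / norm h) *\<^sub>R (f (t + h) - (f t + h *\<^sub>R w))) \<longlongrightarrow> 0) (at_right 0)"
    by (subst (asm) at_right_to_0) (simp add: filterlim_filtermap add.commute)
  moreover have "\<forall>\<^sub>F h in at_right 0.
      (1 / norm h) *\<^sub>R (f (t + h) - (f t + h *\<^sub>R w)) = (f (t + h) - f t) /\<^sub>R h - w"
    using eventually_at_right_less[of "0::real"]
    by eventually_elim (simp add: algebra_simps divide_inverse)
  ultimately have "((\<lambda>h. (f (t + h) - f t) /\<^sub>R h - w) \<longlongrightarrow> 0) (at_right 0)"
    by (rule Lim_transform_eventually)
  then show ?thesis
    by (rule LIM_zero_cancel)
qed

text \<open>
  The bound \<open>N'(v; w) \<le> m\<close>, read as a bound on the limit superior of the difference quotients.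
  Cleared of the denominator \<open>h\<close> and stated with a tolerance \<open>\<epsilon>\<close>, it composes directly with the
  triangle inequality.
\<close>

definition norm_deriv_le :: "('a::real_vector \<Rightarrow> real) \<Rightarrow> 'a \<Rightarrow> 'a \<Rightarrow> real \<Rightarrow> bool" where
  "norm_deriv_le N v w m \<longleftrightarrow>
     (\<forall>\<epsilon>>0. \<forall>\<^sub>F h in at_right 0. N (v + h *\<^sub>R w) \<le> N v + h * (m + \<epsilon>))"

lemma norm_deriv_leD:
  assumes "norm_deriv_le N v w m" and "\<epsilon> > 0"
  shows "\<forall>\<^sub>F h in at_right 0. N (v + h *\<^sub>R w) \<le> N v + h * (m + \<epsilon>)"
  using assms by (simp add: norm_deriv_le_def)

lemma norm_deriv_le_if_osL_le:
  assumes "is_norm N" and "osL_le N G b"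
  shows "norm_deriv_le N (x - y) (G x - G y) (b * N (x - y))"
proof (cases "x = y")
  case True
  have "N 0 = 0"
    by (rule is_norm_zero[OF assms(1)])
  moreover have "\<forall>\<^sub>F h in at_right 0. 0 \<le> h * \<epsilon>" if "\<epsilon> > 0" for \<epsilon> :: real
    using eventually_at_right_less[of "0::real"] by eventually_elim (use that in simp)
  ultimately show ?thesis
    using True by (simp add: norm_deriv_le_def)
next
  case False
  then obtain L where
    L: "((\<lambda>h. (N (x - y + h *\<^sub>R (G x - G y)) - N (x - y)) / h) \<longlongrightarrow> L) (at_right 0)"
    and L_le: "L \<le> b * N (x - y)"
    using assms(2) unfolding osL_le_def by blast
  show ?thesis
    unfolding norm_deriv_le_def
  proof (intro allI impI)
    fix \<epsilon> :: real
    assume "\<epsilon> > 0"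
    then have "L < b * N (x - y) + \<epsilon>"
      using L_le by simp
    then have "\<forall>\<^sub>F h in at_right 0.
        (N (x - y + h *\<^sub>R (G x - G y)) - N (x - y)) / h < b * N (x - y) + \<epsilon>"
      by (rule order_tendstoD(2)[OF L])
    with eventually_at_right_less[of "0::real"]
    show "\<forall>\<^sub>F h in at_right 0.
        N (x - y + h *\<^sub>R (G x - G y)) \<le> N (x - y) + h * (b * N (x - y) + \<epsilon>)"
      by eventually_elim (simp add: pos_divide_less_eq mult.commute)
  qed
qed

text \<open>
  By the triangle inequality the difference quotients are at least \<open>- N w\<close>.  This turns every upper
  bound \<open>m\<close> into information about \<open>w\<close>.
\<close>

lemma norm_deriv_le_lower_bound:
  assumes "is_norm N" and "norm_deriv_le N v w m"
  shows "- N w \<le> m"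
proof (rule field_le_epsilon)
  fix \<epsilon> :: real
  assume "\<epsilon> > 0"
  have "\<forall>\<^sub>F h in at_right (0::real). - N w \<le> m + \<epsilon>"
    using norm_deriv_leD[OF assms(2) \<open>\<epsilon> > 0\<close>] eventually_at_right_less[of "0::real"]
  proof eventually_elim
    case (elim h)
    have "N v \<le> N (v + h *\<^sub>R w) + N (- (h *\<^sub>R w))"
      using is_norm_triangle[OF assms(1), of "v + h *\<^sub>R w" "- (h *\<^sub>R w)"] by simp
    also have "N (- (h *\<^sub>R w)) = h * N w"
      using elim by (simp add: is_norm_minus[OF assms(1)] is_norm_scaleR[OF assms(1)])
    finally have "h * (- N w) \<le> h * (m + \<epsilon>)"
      using elim by simp
    then show ?case
      using \<open>0 < h\<close> by (rule mult_left_le_imp_le)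
  qed
  then show "- N w \<le> m + \<epsilon>"
    by simp
qed

text \<open>Rescaling \<open>v\<close> and \<open>w\<close> together leaves the step size \<open>h\<close> unchanged.\<close>

lemma norm_deriv_le_scaleR_cancel:
  assumes "is_norm N" and "s > 0" and "norm_deriv_le N (s *\<^sub>R v) (s *\<^sub>R w) (s * m)"
  shows "norm_deriv_le N v w m"
  unfolding norm_deriv_le_def
proof (intro allI impI)
  fix \<epsilon> :: real
  assume "\<epsilon> > 0"
  then have "\<forall>\<^sub>F h in at_right 0.
      N (s *\<^sub>R v + h *\<^sub>R (s *\<^sub>R w)) \<le> N (s *\<^sub>R v) + h * (s * m + s * \<epsilon>)"
    using assms(2) by (intro norm_deriv_leD[OF assms(3)]) simp
  then show "\<forall>\<^sub>F h in at_right 0. N (v + h *\<^sub>R w) \<le> N v + h * (m + \<epsilon>)"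
  proof eventually_elim
    case (elim h)
    have "s * N (v + h *\<^sub>R w) = N (s *\<^sub>R (v + h *\<^sub>R w))"
      using assms(2) by (simp add: is_norm_scaleR[OF assms(1)])
    also have "s *\<^sub>R (v + h *\<^sub>R w) = s *\<^sub>R v + h *\<^sub>R (s *\<^sub>R w)"
      by (simp add: scaleR_add_right mult.commute)
    also have "N \<dots> \<le> s * N v + h * (s * m + s * \<epsilon>)"
      using elim assms(2) by (simp add: is_norm_scaleR[OF assms(1)])
    also have "\<dots> = s * (N v + h * (m + \<epsilon>))"
      by (simp add: algebra_simps)
    finally have "s * N (v + h *\<^sub>R w) \<le> s * (N v + h * (m + \<epsilon>))" .
    then show ?case
      using assms(2) by simp
  qed
qed

text \<open>
  Replacing the fixed direction by one that converges to it costs only \<open>o(h)\<close>, since the norm is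
  Lipschitz.
\<close>

lemma norm_deriv_le_varying_direction:
  fixes N :: "'a::euclidean_space \<Rightarrow> real"
  assumes "is_norm N" and "norm_deriv_le N v w m"
    and "(q \<longlongrightarrow> w) (at_right 0)" and "\<epsilon> > 0"
  shows "\<forall>\<^sub>F h in at_right 0. N (v + h *\<^sub>R q h) \<le> N v + h * (m + \<epsilon>)"
proof -
  have "\<forall>\<^sub>F h in at_right 0. N (v + h *\<^sub>R w) \<le> N v + h * (m + \<epsilon> / 2)"
    using assms(4) by (intro norm_deriv_leD[OF assms(2)]) simp
  moreover have "\<forall>\<^sub>F h in at_right 0. N (q h - w) < \<epsilon> / 2"
    using assms(4) by (intro order_tendstoD(2)[OF is_norm_tendsto_diff[OF assms(1,3)]]) simp
  ultimately show ?thesis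
    using eventually_at_right_less[of "0::real"]
  proof eventually_elim
    case (elim h)
    have "N (v + h *\<^sub>R q h) \<le> N (v + h *\<^sub>R w) + N (h *\<^sub>R (q h - w))"
      using is_norm_triangle[OF assms(1), of "v + h *\<^sub>R w" "h *\<^sub>R (q h - w)"]
      by (simp add: algebra_simps)
    also have "\<dots> \<le> (N v + h * (m + \<epsilon> / 2)) + h * (\<epsilon> / 2)"
      using elim by (intro add_mono) (auto simp: is_norm_scaleR[OF assms(1)])
    finally show ?case
      by (simp add: algebra_simps)
  qed
qed

text \<open>
  Upper bounds survive limits in the direction: the difference quotients for \<open>w\<close> and \<open>q s\<close> differ by
  at most \<open>N (q s - w)\<close>, for every step size \<open>h\<close>, so one \<open>s\<close> with a small difference suffices.
\<close>

lemma norm_deriv_le_limit: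
  fixes N :: "'a::euclidean_space \<Rightarrow> real"
  assumes "is_norm N" and "(q \<longlongrightarrow> w) A" and "A \<noteq> bot"
    and "\<forall>\<^sub>F s in A. norm_deriv_le N v (q s) m"
  shows "norm_deriv_le N v w m"
  unfolding norm_deriv_le_def
proof (intro allI impI)
  fix \<epsilon> :: real
  assume "\<epsilon> > 0"
  then have "\<forall>\<^sub>F s in A. N (q s - w) < \<epsilon> / 2"
    by (intro order_tendstoD(2)[OF is_norm_tendsto_diff[OF assms(1,2)]]) simp
  with assms(4) have "\<forall>\<^sub>F s in A. norm_deriv_le N v (q s) m \<and> N (q s - w) < \<epsilon> / 2"
    by (rule eventually_conj)
  then obtain s where s: "norm_deriv_le N v (q s) m" "N (q s - w) < \<epsilon> / 2"
    using assms(3) by (auto dest: eventually_happens)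
  have "\<forall>\<^sub>F h in at_right 0. N (v + h *\<^sub>R q s) \<le> N v + h * (m + \<epsilon> / 2)"
    using \<open>\<epsilon> > 0\<close> by (intro norm_deriv_leD[OF s(1)]) simp
  then show "\<forall>\<^sub>F h in at_right 0. N (v + h *\<^sub>R w) \<le> N v + h * (m + \<epsilon>)"
    using eventually_at_right_less[of "0::real"]
  proof eventually_elim
    case (elim h)
    have "N (v + h *\<^sub>R w) \<le> N (v + h *\<^sub>R q s) + N (h *\<^sub>R (w - q s))"
      using is_norm_triangle[OF assms(1), of "v + h *\<^sub>R q s" "h *\<^sub>R (w - q s)"]
      by (simp add: algebra_simps)
    also have "\<dots> \<le> (N v + h * (m + \<epsilon> / 2)) + h * (\<epsilon> / 2)"
      using elim s(2)
      by (intro add_mono) (auto simp: is_norm_scaleR[OF assms(1)] is_norm_minus_commute[OF assms(1), of w])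
    finally show ?case
      by (simp add: algebra_simps)
  qed
qed

section \<open>Consequences of a one-sided Lipschitz bound\<close>

lemma osL_le_expansive:
  assumes "is_norm N" and "osL_le N G (- c)"
  shows "c * N (x - y) \<le> N (G x - G y)"
  using norm_deriv_le_lower_bound[OF assms(1) norm_deriv_le_if_osL_le[OF assms]] by simp

text \<open>
  The bound of \<open>osL_le\<close> for the points \<open>p + s v\<close> and \<open>p\<close>, divided by \<open>s\<close>, is a bound in the fixed point
  \<open>v\<close> for the direction \<open>(G (p + s v) - G p) / s\<close>.  As \<open>s\<close> tends to \<open>0\<close> this direction tends to the
  derivative.
\<close>

lemma osL_le_derivative:
  fixes N :: "'a::euclidean_space \<Rightarrow> real"
  assumes "is_norm N" and "osL_le N G b" and "(G has_derivative A) (at p)"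
  shows "norm_deriv_le N v (A v) (b * N v)"
proof -
  have "((\<lambda>s. p + s *\<^sub>R v) has_vector_derivative v) (at (0::real))"
    by (auto intro!: derivative_eq_intros)
  moreover have "(G has_derivative A) (at (p + 0 *\<^sub>R v))"
    using assms(3) by simp
  ultimately have "(G \<circ> (\<lambda>s. p + s *\<^sub>R v) has_vector_derivative A v) (at 0)"
    by (intro vector_derivative_diff_chain_within) (auto intro: has_derivative_at_withinI)
  then have "(G \<circ> (\<lambda>s. p + s *\<^sub>R v) has_vector_derivative A v) (at_right 0)"
    by (rule has_vector_derivative_at_within)
  then have lim: "((\<lambda>s. (G (p + s *\<^sub>R v) - G p) /\<^sub>R s) \<longlongrightarrow> A v) (at_right 0)"
    by (auto dest: right_quotient_tendsto)
  have "\<forall>\<^sub>F s in at_right 0. norm_deriv_le N v ((G (p + s *\<^sub>R v) - G p) /\<^sub>R s) (b * N v)"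
    using eventually_at_right_less[of "0::real"]
  proof eventually_elim
    case (elim s)
    have "norm_deriv_le N (p + s *\<^sub>R v - p) (G (p + s *\<^sub>R v) - G p) (b * N (p + s *\<^sub>R v - p))"
      by (rule norm_deriv_le_if_osL_le[OF assms(1,2)])
    then have "norm_deriv_le N (s *\<^sub>R v) (s *\<^sub>R ((G (p + s *\<^sub>R v) - G p) /\<^sub>R s)) (s * (b * N v))"
      using elim by (simp add: is_norm_scaleR[OF assms(1)] mult.left_commute)
    then show ?case
      by (rule norm_deriv_le_scaleR_cancel[OF assms(1) elim])
  qed
  then show ?thesis
    by (rule norm_deriv_le_limit[OF assms(1) lim trivial_limit_at_right_real])
qed

text \<open>If \<open>A v = 0\<close>, then \<open>N'(v; A v) = 0\<close>, and this is at most \<open>- c N v\<close> only for \<open>v = 0\<close>.\<close>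

lemma osL_le_derivative_eq_0_iff:
  fixes N :: "'a::euclidean_space \<Rightarrow> real"
  assumes "is_norm N" and "c > 0" and "osL_le N G (- c)" and "(G has_derivative A) (at p)"
  shows "A v = 0 \<longleftrightarrow> v = 0"
proof
  assume "A v = 0"
  then have "c * N v \<le> 0"
    using norm_deriv_le_lower_bound[OF assms(1) osL_le_derivative[OF assms(1,3,4), of v]]
      is_norm_zero[OF assms(1)] by simp
  then show "v = 0"
    using assms(2) is_norm_nonneg[OF assms(1), of v] is_norm_eq_0_iff[OF assms(1), of v]
    by (simp add: mult_le_0_iff)
next
  assume "v = 0"
  then show "A v = 0"
    using linear_0[OF has_derivative_linear[OF assms(4)]] by simp
qed

section \<open>Comparison for Dini derivatives\<close>

text \<open>
  The last point of \<open>[a, b]\<close> at which \<open>g\<close> does not exceed \<open>g a\<close> can only be \<open>b\<close>, since any earlier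
  point of this kind has another one to its right.
\<close>

lemma locally_right_nonincreasing_le:
  fixes g :: "real \<Rightarrow> real"
  assumes "a \<le> b" and "continuous_on {a..b} g"
    and step: "\<And>t. a \<le> t \<Longrightarrow> t < b \<Longrightarrow> \<forall>\<^sub>F h in at_right 0. g (t + h) \<le> g t"
  shows "g b \<le> g a"
proof -
  define S where "S = {t \<in> {a..b}. g t \<le> g a}"
  have "closed S"
    unfolding S_def
    by (intro continuous_on_closed_Collect_le continuous_on_const assms(2) closed_atLeastAtMost)
  moreover have "bounded S"
    by (rule bounded_subset[OF bounded_closed_interval[of a b]]) (auto simp: S_def)
  ultimately have "compact S"
    by (simp add: compact_eq_bounded_closed)
  moreover have "S \<noteq> {}"
    using assms(1) by (auto simp: S_def)
  ultimately obtain t where t: "t \<in> S" "\<And>s. s \<in> S \<Longrightarrow> s \<le> t"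
    by (meson compact_attains_sup)
  have "t = b"
  proof (rule ccontr)
    assume "t \<noteq> b"
    with t(1) have "a \<le> t" "t < b" and "g t \<le> g a"
      by (auto simp: S_def)
    have "\<forall>\<^sub>F h in at_right 0. h < b - t"
      using \<open>t < b\<close> by (intro eventually_at_rightI[of 0 "b - t"]) auto
    with step[OF \<open>a \<le> t\<close> \<open>t < b\<close>] eventually_at_right_less[of "0::real"]
    have "\<forall>\<^sub>F h in at_right 0. t + h \<in> S \<and> t < t + h"
      by eventually_elim (use \<open>a \<le> t\<close> \<open>g t \<le> g a\<close> in \<open>auto simp: S_def\<close>)
    then obtain h where "t + h \<in> S" "t < t + h"
      by (metis (lifting) eventually_happens' trivial_limit_at_right_real)
    then show False
      using t(2) by fastforce
  qed
  then show ?thesis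
    using t(1) by (simp add: S_def)
qed

text \<open>
  The hypothesis says that the upper right Dini derivative of \<open>f\<close> is at most \<open>- c f\<close>.  With the
  integrating factor \<open>exp (c t)\<close> the Dini derivative becomes nonpositive; the tolerance \<open>\<epsilon>\<close>, which is
  scaled by at most \<open>exp (\<bar>c\<bar> T)\<close> on \<open>[0, T]\<close>, is absorbed by a linear term and then sent to \<open>0\<close>.
\<close>

lemma dini_gronwall:
  fixes f :: "real \<Rightarrow> real"
  assumes "0 \<le> T" and cont: "continuous_on {0..T} f"
    and nonneg: "\<And>t. 0 \<le> t \<Longrightarrow> 0 \<le> f t"
    and dini: "\<And>t \<epsilon>. 0 \<le> t \<Longrightarrow> t < T \<Longrightarrow> \<epsilon> > 0 \<Longrightarrow>
      \<forall>\<^sub>F h in at_right 0. f (t + h) \<le> f t + h * (- c * f t + \<epsilon>)"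
  shows "f T \<le> exp (- c * T) * f 0"
proof -
  define M where "M = exp (\<bar>c\<bar> * T)"
  have "exp (c * T) * f T \<le> f 0 + \<eta>" if "\<eta> > 0" for \<eta>
  proof -
    \<comment> \<open>The linear term of \<open>g\<close> below reaches \<open>M * \<epsilon> * T\<close>, which must stay below \<open>\<eta>\<close>; dividing by
      \<open>T + 1\<close> instead of \<open>T\<close> covers \<open>T = 0\<close>.\<close>
    define \<epsilon> where "\<epsilon> = \<eta> / (M * (T + 1))"
    have "M > 0"
      by (simp add: M_def)
    then have "\<epsilon> > 0"
      using that assms(1) by (simp add: \<epsilon>_def)
    define g where "g t = exp (c * t) * f t - M * \<epsilon> * t" for t
    have "g T \<le> g 0"
    proof (rule locally_right_nonincreasing_le[OF assms(1)])
      show "continuous_on {0..T} g"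
        unfolding g_def by (intro continuous_intros cont)
    next
      fix t :: real
      assume t: "0 \<le> t" "t < T"
      have "\<forall>\<^sub>F h in at_right 0. h < T - t"
        using t by (intro eventually_at_rightI[of 0 "T - t"]) auto
      with dini[OF t \<open>\<epsilon> > 0\<close>] eventually_at_right_less[of "0::real"]
      show "\<forall>\<^sub>F h in at_right 0. g (t + h) \<le> g t"
      proof eventually_elim
        case (elim h)
        define E where "E = exp (c * (t + h))"
        have "E > 0"
          by (simp add: E_def)
        have "c * (t + h) \<le> \<bar>c\<bar> * T"
          using elim t by (intro mult_mono) auto
        then have "E \<le> M"
          by (simp add: E_def M_def)
        \<comment> \<open>The tangent of the exponential at \<open>t + h\<close> lies below its graph at \<open>t\<close>.\<close>
        have "E * (1 + (- c * h)) \<le> E * exp (- c * h)"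
          using \<open>E > 0\<close> exp_ge_add_one_self[of "- c * h"] by (intro mult_left_mono) auto
        also have "E * exp (- c * h) = exp (c * t)"
          by (simp add: E_def algebra_simps flip: exp_add)
        finally have tangent: "E * (1 - c * h) \<le> exp (c * t)"
          by simp
        have "E * f (t + h) \<le> E * (f t + h * (- c * f t + \<epsilon>))"
          using \<open>E > 0\<close> elim by (intro mult_left_mono) auto
        also have "\<dots> = E * (1 - c * h) * f t + E * (\<epsilon> * h)"
          by (simp add: algebra_simps)
        also have "\<dots> \<le> exp (c * t) * f t + M * (\<epsilon> * h)"
          using tangent \<open>E \<le> M\<close> nonneg[OF t(1)] \<open>\<epsilon> > 0\<close> elim
          by (intro add_mono mult_right_mono) auto
        finally show ?case
          by (simp add: g_def E_def algebra_simps)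
      qed
    qed
    moreover have "M * \<epsilon> * T \<le> \<eta>"
    proof -
      have "M * \<epsilon> * T = \<eta> * (T / (T + 1))"
        using \<open>M > 0\<close> by (simp add: \<epsilon>_def)
      also have "\<dots> \<le> \<eta> * 1"
        using that assms(1) by (intro mult_left_mono) (auto simp: divide_le_eq)
      finally show ?thesis
        by simp
    qed
    ultimately show ?thesis
      by (simp add: g_def)
  qed
  then have "exp (c * T) * f T \<le> f 0"
    by (rule field_le_epsilon)
  then have "exp (- c * T) * (exp (c * T) * f T) \<le> exp (- c * T) * f 0"
    by (intro mult_left_mono) auto
  then show ?thesis
    by (simp add: mult.assoc[symmetric] flip: exp_add)
qed

lemma norm_decay_if_norm_deriv_le:
  fixes N :: "'a::euclidean_space \<Rightarrow> real"
  assumes "is_norm N"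
    and deriv: "\<And>t. 0 \<le> t \<Longrightarrow> (y has_vector_derivative w t) (at t within {0..})"
    and bound: "\<And>t. 0 \<le> t \<Longrightarrow> norm_deriv_le N (y t) (w t) (- c * N (y t))"
    and "0 \<le> T"
  shows "N (y T) \<le> exp (- c * T) * N (y 0)"
proof (rule dini_gronwall[OF assms(4)])
  have "continuous_on {0..} y"
    using deriv by (auto intro: continuous_on_vector_derivative)
  then have "continuous_on {0..T} y"
    by (rule continuous_on_subset) auto
  then show "continuous_on {0..T} (\<lambda>t. N (y t))"
    by (intro continuous_on_compose2[OF is_norm_continuous_on[OF assms(1), of UNIV]]) auto
next
  show "0 \<le> N (y t)" for t
    by (rule is_norm_nonneg[OF assms(1)])
next
  fix t \<epsilon> :: real
  assume t: "0 \<le> t" "t < T" and "\<epsilon> > 0"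
  have "(y has_vector_derivative w t) (at_right t)"
    by (rule has_vector_derivative_within_subset[OF deriv[OF t(1)]]) (use t in auto)
  then have "((\<lambda>h. (y (t + h) - y t) /\<^sub>R h) \<longlongrightarrow> w t) (at_right 0)"
    by (rule right_quotient_tendsto)
  from norm_deriv_le_varying_direction[OF assms(1) bound[OF t(1)] this \<open>\<epsilon> > 0\<close>]
    eventually_at_right_less[of "0::real"]
  show "\<forall>\<^sub>F h in at_right 0. N (y (t + h)) \<le> N (y t) + h * (- c * N (y t) + \<epsilon>)"
    by eventually_elim simp
qed

section \<open>The residual along the feedforward dynamics\<close>

lemma has_derivative_Pair_left:
  assumes "(F has_derivative D) (at (p, q))"
  shows "((\<lambda>u. F (u, q)) has_derivative (\<lambda>u. D (u, 0))) (at p)"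
  by (rule has_derivative_compose[of "\<lambda>u. (u, q)", OF _ assms])
    (auto intro!: derivative_eq_intros)

lemma has_derivative_Pair_right:
  assumes "(F has_derivative D) (at (p, q))"
  shows "((\<lambda>u. F (p, u)) has_derivative (\<lambda>u. D (0, u))) (at q)"
  by (rule has_derivative_compose[of "\<lambda>u. (p, u)", OF _ assms])
    (auto intro!: derivative_eq_intros)

lemma jacobian_mult_vector:
  fixes f :: "real ^ 'm \<Rightarrow> real ^ 'k"
  assumes "(f has_derivative D) (at p)"
  shows "jacobian f (at p) *v u = D u"
proof -
  have "frechet_derivative f (at p) = D"
    using assms by (rule frechet_derivative_at[symmetric])
  then show ?thesis
    using has_derivative_linear[OF assms] by (simp add: jacobian_def matrix_works)
qed

text \<open>
  The chain rule gives \<open>D\<^sub>xF x' + D\<^sub>\<theta>F \<theta>'\<close>, and multiplying the feedforward term of \<open>x'\<close> by \<open>D\<^sub>xF\<close> yields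
  \<open>- D\<^sub>\<theta>F \<theta>'\<close> exactly.  Only the product of \<open>D\<^sub>xF\<close> with \<open>F\<close> survives.
\<close>

lemma residual_derivative:
  fixes F :: "(real ^ 'n) \<times> (real ^ 'd) \<Rightarrow> real ^ 'n"
  assumes F: "(F has_derivative D) (at (x t, \<theta> t))"
    and x: "(x has_vector_derivative
      F (x t, \<theta> t) - matrix_inv (Jac_x F (x t) (\<theta> t)) *v (Jac_theta F (x t) (\<theta> t) *v \<theta>'))
      (at t within S)"
    and \<theta>: "(\<theta> has_vector_derivative \<theta>') (at t within S)"
    and inj: "\<And>v. D (v, 0) = 0 \<Longrightarrow> v = 0"
  shows "((\<lambda>s. F (x s, \<theta> s)) has_vector_derivative D (F (x t, \<theta> t), 0)) (at t within S)"
proof -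
  define A where "A = Jac_x F (x t) (\<theta> t)"
  define B where "B = Jac_theta F (x t) (\<theta> t)"
  define x' where "x' = F (x t, \<theta> t) - matrix_inv A *v (B *v \<theta>')"
  have A: "A *v u = D (u, 0)" for u
    unfolding A_def Jac_x_def by (rule jacobian_mult_vector[OF has_derivative_Pair_left[OF F]])
  have B: "B *v u = D (0, u)" for u
    unfolding B_def Jac_theta_def by (rule jacobian_mult_vector[OF has_derivative_Pair_right[OF F]])
  have "invertible A"
    using inj by (simp add: invertible_left_inverse matrix_left_invertible_ker A)
  then have "A ** matrix_inv A = mat 1"
    unfolding invertible_def matrix_inv_def by (rule someI2_ex) simp
  then have cancel: "A *v (matrix_inv A *v u) = u" for u
    by (simp add: matrix_vector_mul_assoc)
  have "D (x', \<theta>') = D (x', 0) + D (0, \<theta>')"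
    using linear_add[OF has_derivative_linear[OF F], of "(x', 0)" "(0, \<theta>')"] by simp
  also have "\<dots> = A *v x' + B *v \<theta>'"
    by (simp add: A B)
  also have "\<dots> = A *v F (x t, \<theta> t)"
    by (simp add: x'_def matrix_vector_mult_diff_distrib cancel)
  finally have "D (x', \<theta>') = D (F (x t, \<theta> t), 0)"
    by (simp add: A)
  moreover have "((\<lambda>s. (x s, \<theta> s)) has_vector_derivative (x', \<theta>')) (at t within S)"
    using x \<theta> unfolding x'_def A_def B_def by (rule has_vector_derivative_Pair)
  then have "(F \<circ> (\<lambda>s. (x s, \<theta> s)) has_vector_derivative D (x', \<theta>')) (at t within S)"
    by (rule vector_derivative_diff_chain_within) (rule has_derivative_at_withinI[OF F])
  ultimately show ?thesis
    by (simp add: o_def)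
qed

section \<open>Exponential tracking\<close>

theorem theorem3:
  fixes F :: "(real ^ 'n) \<times> (real ^ 'd) \<Rightarrow> real ^ 'n"
    and \<Theta> :: "(real ^ 'd) set"
    and X :: "(real ^ 'n) set"
    and N :: "real ^ 'n \<Rightarrow> real"
    and c :: real
    and \<theta> :: "real \<Rightarrow> real ^ 'd"
    and x :: "real \<Rightarrow> real ^ 'n"
  assumes F_C1: "continuously_differentiable F"
    and theta_range: "\<forall>t\<ge>0. \<theta> t \<in> \<Theta>"
    and theta_C1: "C1_nonneg \<theta>"
    and norm_N: "is_norm N"
    and c_pos: "c > 0"
    and contracting: "\<forall>\<theta>\<in>\<Theta>. osL_le N (\<lambda>x. F (x, \<theta>)) (- c)"
    and equilibria: "\<forall>\<theta>\<in>\<Theta>. \<exists>!x. x \<in> X \<and> F (x, \<theta>) = 0"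
    and x_range: "\<forall>t\<ge>0. x t \<in> X"
    and solution: "feedforward_solution F \<theta> x"
  shows "(\<forall>t\<ge>0. N (F (x t, \<theta> t)) \<le> exp (- c * t) * N (F (x 0, \<theta> 0)))
    \<and> (\<forall>t\<ge>0. N (x t - equilibrium F X (\<theta> t)) \<le> 1 / c * exp (- c * t) * N (F (x 0, \<theta> 0)))
    \<and> (\<forall>l. (\<forall>\<theta>\<in>\<Theta>. \<forall>u v. N (F (u, \<theta>) - F (v, \<theta>)) \<le> l * N (u - v)) \<longrightarrow>
          (\<forall>t\<ge>0. N (x t - equilibrium F X (\<theta> t))
                  \<le> l / c * exp (- c * t) * N (x 0 - equilibrium F X (\<theta> 0))))"
proof -
  obtain F' where F': "(F has_derivative blinfun_apply (F' z)) (at z)" for z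
    using F_C1 unfolding continuously_differentiable_def by blast
  define y where "y t = F (x t, \<theta> t)" for t
  define A where "A t v = blinfun_apply (F' (x t, \<theta> t)) (v, 0)" for t v
  have osL: "osL_le N (\<lambda>u. F (u, \<theta> t)) (- c)" if "0 \<le> t" for t
    using contracting theta_range that by blast
  have A: "((\<lambda>u. F (u, \<theta> t)) has_derivative A t) (at (x t))" for t
    unfolding A_def by (rule has_derivative_Pair_left[OF F'])
  have y_deriv: "(y has_vector_derivative A t (y t)) (at t within {0..})" if "0 \<le> t" for t
    unfolding y_def A_def
  proof (rule residual_derivative[OF F'])
    show "(x has_vector_derivative
        F (x t, \<theta> t) - matrix_inv (Jac_x F (x t) (\<theta> t)) *v (Jac_theta F (x t) (\<theta> t) *v dot \<theta> t))
        (at t within {0..})"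
      using solution that unfolding feedforward_solution_def by blast
    show "(\<theta> has_vector_derivative dot \<theta> t) (at t within {0..})"
      using theta_C1 that unfolding C1_nonneg_def by blast
    show "v = 0" if "blinfun_apply (F' (x t, \<theta> t)) (v, 0) = 0" for v
      using that osL_le_derivative_eq_0_iff[OF norm_N c_pos osL[OF \<open>0 \<le> t\<close>] A]
      by (simp add: A_def)
  qed
  have decay: "N (y t) \<le> exp (- c * t) * N (y 0)" if "0 \<le> t" for t
    using y_deriv osL_le_derivative[OF norm_N osL A] that
    by (rule norm_decay_if_norm_deriv_le[OF norm_N])
  have root: "F (equilibrium F X (\<theta> t), \<theta> t) = 0" if "0 \<le> t" for t
  proof -
    have "\<exists>!u. u \<in> X \<and> F (u, \<theta> t) = 0"
      using equilibria theta_range that by blast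
    then show ?thesis
      unfolding equilibrium_def by (rule theI'[THEN conjunct2])
  qed
  have "c * N (x t - equilibrium F X (\<theta> t)) \<le> N (y t)" if "0 \<le> t" for t
    using osL_le_expansive[OF norm_N osL[OF that], of "x t" "equilibrium F X (\<theta> t)"] root[OF that]
    by (simp add: y_def)
  then have "c * N (x t - equilibrium F X (\<theta> t)) \<le> exp (- c * t) * N (y 0)" if "0 \<le> t" for t
    using decay that by (meson order_trans)
  then have tracking: "N (x t - equilibrium F X (\<theta> t)) \<le> 1 / c * exp (- c * t) * N (y 0)"
    if "0 \<le> t" for t
    using that c_pos by (simp add: pos_le_divide_eq mult.commute[of _ c])
  have "N (x t - equilibrium F X (\<theta> t)) \<le> l / c * exp (- c * t) * N (x 0 - equilibrium F X (\<theta> 0))"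
    if lip: "\<forall>\<theta>\<in>\<Theta>. \<forall>u v. N (F (u, \<theta>) - F (v, \<theta>)) \<le> l * N (u - v)" and "0 \<le> t" for l t
  proof -
    have "\<theta> 0 \<in> \<Theta>"
      using theta_range by simp
    then have "N (F (x 0, \<theta> 0) - F (equilibrium F X (\<theta> 0), \<theta> 0))
        \<le> l * N (x 0 - equilibrium F X (\<theta> 0))"
      using lip by blast
    then have "N (y 0) \<le> l * N (x 0 - equilibrium F X (\<theta> 0))"
      by (simp add: y_def root)
    then have "1 / c * exp (- c * t) * N (y 0)
        \<le> 1 / c * exp (- c * t) * (l * N (x 0 - equilibrium F X (\<theta> 0)))"
      using c_pos by (intro mult_left_mono) auto
    with tracking[OF \<open>0 \<le> t\<close>] show ?thesis
      by (simp add: ac_simps)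
  qed
  with decay tracking show ?thesis
    unfolding y_def by blast
qed

end
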